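(* Consider Method 1.4 (described in the context) and suppose it does not terminate and the generated sequence $\{x_k\}_{k\in K}$ is bounded. Then every limit point of $\{x_k\}_{k\in K}$ belongs to $X^*$.
   Context: Setting: $f_j$, $j\in J=\{1,\dots,m\}$, convex on $\mathbb{R}^n$ with $D_j=\{x:f_j(x)\le0\}$ having nonempty interior; $D=\{x:f_j(x)\le0\ \forall j\}$; $f$ continuous, attaining its minimum on $D$. Notation: $K=\{0,1,\dots\}$, $f^*=\min_Df$, $X^*=\{x\in D: f(x)=f^*\}$, $W^1(x,D_j)=\{a:\|a\|=1,\ \langle a,z-x\rangle\le0\ \forall z\in D_j\}$. Method 1.4: choose a closed convex $M_0\subset\mathbb{R}^n$ containing at least one point of $X^*$, points $y^j\in\operatorname{int}D_j$, a constant $q\ge1$, and a point $x_0\in M_0$ with $f(x_0)\le f^*$. Given $x_k$: Step 1: if $x_k\in D$, stop. Step 2: $J_k=\{j:x_k\notin D_j\}$. Step 3: for $j\in J_k$ choose $z_k^j$ in the open segment $(y^j,x_k)$ with $z_k^j\notin\operatorname{int}D_j$ and $x_k+q_k^j(z_k^j-x_k)\in D_j$ for some $q_k^j\in[1,q]$. Step 4: for $j\in J_k$ choose a nonempty finite $A_k^j\subset W^1(z_k^j,D_j)$, set $M_k^j=M_k\cap\{x:\langle a,x-z_k^j\rangle\le0\ \forall a\in A_k^j\}$ and choose $u_k^j\in M_k^j$ with $f(u_k^j)\le f^*$. Step 5: find $j_k\in J_k$ with $\|x_k-z_k^{j_k}\|=\max_{j\in J_k}\|x_k-z_k^j\|$.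 Step 6: $J_k'=\{j\in J_k: u_k^j\in M_k^{j_k}\}$; find $l_k\in J_k'$ with $f(u_k^{l_k})=\max_{j\in J_k'}f(u_k^j)$. Step 7: $M_{k+1}=M_k^{j_k}\cap\{x:\langle a,x-z_k^{l_k}\rangle\le0\ \forall a\in A_k^{l_k}\}$, $x_{k+1}=u_k^{l_k}$. *)

theory Defs
  imports "HOL-Analysis.Analysis"
begin

definition Dj :: "(nat \<Rightarrow> 'a \<Rightarrow> real) \<Rightarrow> nat \<Rightarrow> 'a set" where
  "Dj fs j = {x. fs j x \<le> 0}"

definition Dset :: "nat \<Rightarrow> (nat \<Rightarrow> 'a \<Rightarrow> real) \<Rightarrow> 'a set" where
  "Dset m fs = {x. \<forall>j\<in>{1..m}. fs j x \<le> 0}"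

text \<open>f* = min over D of f (the minimum is assumed to be attained).\<close>
definition fstar :: "nat \<Rightarrow> (nat \<Rightarrow> 'a \<Rightarrow> real) \<Rightarrow> ('a \<Rightarrow> real) \<Rightarrow> real" where
  "fstar m fs f = Inf (f ` Dset m fs)"

definition Xstar :: "nat \<Rightarrow> (nat \<Rightarrow> 'a \<Rightarrow> real) \<Rightarrow> ('a \<Rightarrow> real) \<Rightarrow> 'a set" where
  "Xstar m fs f = {x \<in> Dset m fs. f x = fstar m fs f}"

definition W1 :: "'a::real_inner \<Rightarrow> 'a set \<Rightarrow> 'a set" where
  "W1 x S = {a. norm a = 1 \<and> (\<forall>z\<in>S. inner a (z - x) \<le> 0)}"

definition cut :: "'a::real_inner set \<Rightarrow> 'a \<Rightarrow> 'a set" where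
  "cut A z = {x. \<forall>a\<in>A. inner a (x - z) \<le> 0}"

text \<open>A non-terminating run of Method 1.4, with all choices made explicit:
  M k = M_k, x k = x_k, z k j = z_k^j, A k j = A_k^j, u k j = u_k^j,
  jk k = j_k, lk k = l_k.  J_k = {j in J. x_k not in D_j}.\<close>
definition method14_run ::
  "nat \<Rightarrow> (nat \<Rightarrow> 'a::euclidean_space \<Rightarrow> real) \<Rightarrow> ('a \<Rightarrow> real) \<Rightarrow> (nat \<Rightarrow> 'a) \<Rightarrow> real
   \<Rightarrow> (nat \<Rightarrow> 'a set) \<Rightarrow> (nat \<Rightarrow> 'a) \<Rightarrow> (nat \<Rightarrow> nat \<Rightarrow> 'a) \<Rightarrow> (nat \<Rightarrow> nat \<Rightarrow> 'a set)
   \<Rightarrow> (nat \<Rightarrow> nat \<Rightarrow> 'a) \<Rightarrow> (nat \<Rightarrow> nat) \<Rightarrow> (nat \<Rightarrow> nat) \<Rightarrow> bool" where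
  "method14_run m fs f y q M x z A u jk lk \<longleftrightarrow>
     closed (M 0) \<and> convex (M 0) \<and> M 0 \<inter> Xstar m fs f \<noteq> {} \<and>
     (\<forall>j\<in>{1..m}. y j \<in> interior (Dj fs j)) \<and> q \<ge> 1 \<and>
     x 0 \<in> M 0 \<and> f (x 0) \<le> fstar m fs f \<and>
     (\<forall>k. x k \<notin> Dset m fs \<and>
        (let Jk = {j\<in>{1..m}. x k \<notin> Dj fs j};
             Mk = (\<lambda>j. M k \<inter> cut (A k j) (z k j));
             Jk' = {j\<in>Jk. u k j \<in> Mk (jk k)}
         in (\<forall>j\<in>Jk.
               z k j \<in> open_segment (y j) (x k) \<and> z k j \<notin> interior (Dj fs j) \<and>
               (\<exists>qkj. 1 \<le> qkj \<and> qkj \<le> q \<and> x k + qkj *\<^sub>R (z k j - x k) \<in> Dj fs j) \<and>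
               finite (A k j) \<and> A k j \<noteq> {} \<and> A k j \<subseteq> W1 (z k j) (Dj fs j) \<and>
               u k j \<in> Mk j \<and> f (u k j) \<le> fstar m fs f) \<and>
            jk k \<in> Jk \<and> (\<forall>j\<in>Jk. norm (x k - z k j) \<le> norm (x k - z k (jk k))) \<and>
            lk k \<in> Jk' \<and> (\<forall>j\<in>Jk'. f (u k j) \<le> f (u k (lk k))) \<and>
            M (Suc k) = Mk (jk k) \<inter> cut (A k (lk k)) (z k (lk k)) \<and>
            x (Suc k) = u k (lk k)))"

end

theory Submission
  imports Defs
begin

text \<open>For \<open>k < k'\<close> the iterate \<open>x k'\<close> lies in the cut of \<open>A k (jk k)\<close> at
  \<open>z k (jk k)\<close>. These normals support \<open>D_(jk k)\<close>, which contains a ball of a fixed radius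
  \<open>c\<close> around \<open>y (jk k)\<close>, so \<open>\<parallel>x k - z k (jk k)\<parallel> \<le> (B / c) \<parallel>x k' - x k\<parallel>\<close>, where
  \<open>B\<close> bounds all \<open>\<parallel>x k - y j\<parallel>\<close>. Along a convergent subsequence the right-hand side tends
  to 0, hence so does the largest step \<open>\<parallel>x k - z k j\<parallel>\<close>; the points
  \<open>x k + q_k^j (z k j - x k) \<in> D_j\<close> then show that the limit \<open>p\<close> lies in every closed set
  \<open>D_j\<close>. Finally \<open>f (x k) \<le> f*\<close> for all \<open>k\<close>, so \<open>f p \<le> f* \<le> f p\<close> by continuity.\<close>

lemma closed_sublevel_convex_on:
  fixes g :: "'a::euclidean_space \<Rightarrow> real"
  assumes "convex_on UNIV g"
  shows "closed {x. g x \<le> c}"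
  using convex_on_continuous[OF open_UNIV assms] by (intro closed_Collect_le) auto

lemma finite_common_cball_radius:
  assumes "finite I" and "\<And>i. i \<in> I \<Longrightarrow> y i \<in> interior (S i)"
  obtains c where "c > 0" and "\<And>i. i \<in> I \<Longrightarrow> cball (y i) c \<subseteq> S i"
  using assms
proof (induction I arbitrary: thesis rule: finite_induct)
  case empty
  show ?case by (rule empty.prems(1)[of 1]) auto
next
  case (insert j I)
  obtain c where c: "c > 0" "\<And>i. i \<in> I \<Longrightarrow> cball (y i) c \<subseteq> S i"
    using insert.IH insert.prems(2) by blast
  obtain e where e: "e > 0" "cball (y j) e \<subseteq> S j"
    using insert.prems(2) mem_interior_cball by blast
  show ?case
  proof (rule insert.prems(1)[of "min c e"])
    fix i assume "i \<in> insert j I"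
    then show "cball (y i) (min c e) \<subseteq> S i"
      using c e subset_cball[of "min c e"] by fastforce
  qed (use c e in auto)
qed

lemma bounded_range_norm_diff_bound:
  fixes x y :: "_ \<Rightarrow> 'a::real_normed_vector"
  assumes "bounded (range x)" and "finite I"
  obtains B where "B > 0" and "\<And>k i. i \<in> I \<Longrightarrow> norm (x k - y i) \<le> B"
proof -
  obtain Bx where Bx: "\<And>k. norm (x k) \<le> Bx"
    using assms(1) by (meson bounded_iff rangeI)
  obtain By where By: "By > 0" "\<And>i. i \<in> I \<Longrightarrow> norm (y i) \<le> By"
    using finite_imp_bounded[of "y ` I"] assms(2) by (auto simp: bounded_pos)
  show thesis
  proof
    show "\<bar>Bx\<bar> + By > 0" using By by simp
    fix k i assume "i \<in> I"
    then show "norm (x k - y i) \<le> \<bar>Bx\<bar> + By"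
      using Bx[of k] By(2) norm_triangle_ineq4[of "x k" "y i"] by fastforce
  qed
qed

text \<open>The whole ball \<open>cball y c\<close> lies on the inner side of the supporting normal \<open>a\<close>
  at \<open>z\<close>, which forces \<open>\<langle>a, x - y\<rangle> \<ge> c\<close>.\<close>

lemma cut_point_far_from_segment_end:
  fixes x x' y z a :: "'a::real_inner"
  assumes z: "z \<in> open_segment y x" and a: "a \<in> W1 z S"
    and ball: "cball y c \<subseteq> S" and c: "0 \<le> c"
    and xy: "norm (x - y) \<le> B" and cut: "inner a (x' - z) \<le> 0"
  shows "c * norm (x - z) \<le> B * norm (x' - x)"
proof -
  obtain s where s: "0 < s" "s < 1" and zs: "z = (1 - s) *\<^sub>R y + s *\<^sub>R x"
    using z by (auto simp: in_segment)
  have na: "norm a = 1" and supp: "\<And>w. w \<in> S \<Longrightarrow> inner a (w - z) \<le> 0"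
    using a by (auto simp: W1_def)
  have "y + c *\<^sub>R a \<in> S" using ball c na by (auto simp: dist_norm)
  then have "inner a (y + c *\<^sub>R a - z) \<le> 0" by (rule supp)
  also have "y + c *\<^sub>R a - z = c *\<^sub>R a - s *\<^sub>R (x - y)" by (simp add: zs algebra_simps)
  finally have "c \<le> s * inner a (x - y)"
    using na by (simp add: inner_diff_right dot_square_norm)
  then have ca: "c \<le> inner a (x - y)"
    using s c mult_left_le_one_le[of "inner a (x - y)" s] mult_pos_neg[of s "inner a (x - y)"]
    by linarith
  have B: "0 \<le> B" using xy norm_ge_zero order_trans by blast
  have xz: "x - z = (1 - s) *\<^sub>R (x - y)" by (simp add: zs algebra_simps)
  have "c * norm (x - z) = (1 - s) * (c * norm (x - y))" using s by (simp add: xz)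
  also have "\<dots> \<le> (1 - s) * (B * inner a (x - y))"
    using s c mult_mono[OF xy ca B c] by (intro mult_left_mono) (auto simp: mult.commute)
  also have "\<dots> = B * inner a (x - z)" by (simp add: xz)
  also have "\<dots> \<le> B * inner a (x - x')"
    using cut B by (intro mult_left_mono) (auto simp: inner_diff_right)
  also have "\<dots> \<le> B * norm (x' - x)"
    using norm_cauchy_schwarz[of a "x - x'"] na B
    by (intro mult_left_mono) (auto simp: norm_minus_commute)
  finally show ?thesis .
qed

lemma fstar_le:
  assumes "\<exists>x0\<in>Dset m fs. \<forall>x\<in>Dset m fs. f x0 \<le> f x" and "p \<in> Dset m fs"
  shows "fstar m fs f \<le> f p"
  using assms unfolding fstar_def by (auto intro!: cInf_lower bdd_belowI2)

locale method14 =
  fixes m :: nat and fs :: "nat \<Rightarrow> 'a::euclidean_space \<Rightarrow> real" and f :: "'a \<Rightarrow> real"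
    and y :: "nat \<Rightarrow> 'a" and q :: real and M :: "nat \<Rightarrow> 'a set" and x :: "nat \<Rightarrow> 'a"
    and z :: "nat \<Rightarrow> nat \<Rightarrow> 'a" and A :: "nat \<Rightarrow> nat \<Rightarrow> 'a set" and u :: "nat \<Rightarrow> nat \<Rightarrow> 'a"
    and jk lk :: "nat \<Rightarrow> nat"
  assumes run: "method14_run m fs f y q M x z A u jk lk"
begin

definition active :: "nat \<Rightarrow> nat set" where
  "active k = {j \<in> {1..m}. x k \<notin> Dj fs j}"

lemma y_interior: "j \<in> {1..m} \<Longrightarrow> y j \<in> interior (Dj fs j)"
  using run unfolding method14_run_def by blast

lemma q_ge_1: "1 \<le> q"
  using run unfolding method14_run_def by blast

lemma f_x0_le_fstar: "f (x 0) \<le> fstar m fs f"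
  using run unfolding method14_run_def by blast

lemma active_step:
  assumes "j \<in> active k"
  shows "z k j \<in> open_segment (y j) (x k)"
    and "\<exists>t. 1 \<le> t \<and> t \<le> q \<and> x k + t *\<^sub>R (z k j - x k) \<in> Dj fs j"
    and "A k j \<noteq> {}" and "A k j \<subseteq> W1 (z k j) (Dj fs j)"
    and "u k j \<in> M k \<inter> cut (A k j) (z k j)" and "f (u k j) \<le> fstar m fs f"
  using run assms unfolding method14_run_def Let_def active_def by blast+

lemma jk_active: "jk k \<in> active k"
  and norm_z_le_norm_z_jk: "j \<in> active k \<Longrightarrow> norm (x k - z k j) \<le> norm (x k - z k (jk k))"
  and lk_active: "lk k \<in> active k"
  and u_lk_mem_cut_jk: "u k (lk k) \<in> cut (A k (jk k)) (z k (jk k))"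
  and M_Suc: "M (Suc k) = M k \<inter> cut (A k (jk k)) (z k (jk k)) \<inter> cut (A k (lk k)) (z k (lk k))"
  and x_Suc: "x (Suc k) = u k (lk k)"
  using run unfolding method14_run_def Let_def active_def by blast+

lemma M_antimono: "k \<le> k' \<Longrightarrow> M k' \<subseteq> M k"
  by (rule lift_Suc_antimono_le[of M]) (auto simp: M_Suc)

lemma x_Suc_mem_M_Suc: "x (Suc k) \<in> M (Suc k)"
  using active_step(5)[OF lk_active] u_lk_mem_cut_jk by (simp add: M_Suc x_Suc)

lemma later_x_mem_cut_jk:
  assumes "k < k'"
  shows "x k' \<in> cut (A k (jk k)) (z k (jk k))"
proof -
  obtain k'' where k'': "k' = Suc k''" "k \<le> k''" using assms by (cases k') auto
  have "x k' \<in> M (Suc k)"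
    using x_Suc_mem_M_Suc[of k''] M_antimono[of "Suc k" "Suc k''"] k'' by auto
  then show ?thesis by (simp add: M_Suc)
qed

lemma f_x_le_fstar: "f (x k) \<le> fstar m fs f"
  using f_x0_le_fstar active_step(6)[OF lk_active] by (cases k) (auto simp: x_Suc)

lemma norm_x_z_jk_le_later_step:
  assumes "bounded (range x)"
  obtains C where "\<And>k k'. k < k' \<Longrightarrow> norm (x k - z k (jk k)) \<le> C * norm (x k' - x k)"
proof -
  obtain c where c: "c > 0" "\<And>j. j \<in> {1..m} \<Longrightarrow> cball (y j) c \<subseteq> Dj fs j"
    using finite_common_cball_radius[of "{1..m}" y "Dj fs"] y_interior by auto
  obtain B where B: "B > 0" "\<And>k j. j \<in> {1..m} \<Longrightarrow> norm (x k - y j) \<le> B"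
    using bounded_range_norm_diff_bound[OF assms, of "{1..m}" y] by auto
  show thesis
  proof (rule that[of "B / c"])
    fix k k' :: nat assume "k < k'"
    have j: "jk k \<in> {1..m}" using jk_active by (simp add: active_def)
    obtain a where a: "a \<in> A k (jk k)" using active_step(3)[OF jk_active] by blast
    have "c * norm (x k - z k (jk k)) \<le> B * norm (x k' - x k)"
    proof (rule cut_point_far_from_segment_end)
      show "z k (jk k) \<in> open_segment (y (jk k)) (x k)"
        by (rule active_step(1)[OF jk_active])
      show "a \<in> W1 (z k (jk k)) (Dj fs (jk k))"
        using active_step(4)[OF jk_active] a by blast
      show "inner a (x k' - z k (jk k)) \<le> 0"
        using later_x_mem_cut_jk[OF \<open>k < k'\<close>] a by (auto simp: cut_def)
    qed (use c B j in auto)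
    then show "norm (x k - z k (jk k)) \<le> B / c * norm (x k' - x k)"
      using c by (simp add: field_simps)
  qed
qed

lemma norm_x_z_jk_subseq_tendsto_zero:
  assumes "bounded (range x)" and "strict_mono r" and "(\<lambda>i. x (r i)) \<longlonglongrightarrow> p"
  shows "(\<lambda>i. norm (x (r i) - z (r i) (jk (r i)))) \<longlonglongrightarrow> 0"
proof -
  obtain C where C: "\<And>k k'. k < k' \<Longrightarrow> norm (x k - z k (jk k)) \<le> C * norm (x k' - x k)"
    using norm_x_z_jk_le_later_step[OF assms(1)] by blast
  have "(\<lambda>i. x (r (Suc i)) - x (r i)) \<longlonglongrightarrow> p - p"
    using LIMSEQ_Suc[OF assms(3)] assms(3) by (rule tendsto_diff)
  then have lim0: "(\<lambda>i. C * norm (x (r (Suc i)) - x (r i))) \<longlonglongrightarrow> 0"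
    by (simp add: tendsto_mult_right_zero tendsto_norm_zero)
  have bound: "norm (norm (x (r i) - z (r i) (jk (r i))))
      \<le> C * norm (x (r (Suc i)) - x (r i))" for i
    using C[OF strict_monoD[OF assms(2), of i "Suc i"]] by simp
  show ?thesis
    by (rule Lim_null_comparison[OF always_eventually[OF allI]]) (rule bound, rule lim0)
qed

lemma infdist_x_Dj_le:
  assumes "j \<in> {1..m}"
  shows "infdist (x k) (Dj fs j) \<le> q * norm (x k - z k (jk k))"
proof (cases "x k \<in> Dj fs j")
  case True
  then show ?thesis using q_ge_1 by simp
next
  case False
  then have j: "j \<in> active k" using assms by (simp add: active_def)
  obtain t where t: "1 \<le> t" "t \<le> q" "x k + t *\<^sub>R (z k j - x k) \<in> Dj fs j"
    using active_step(2)[OF j] by blast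
  have "infdist (x k) (Dj fs j) \<le> dist (x k) (x k + t *\<^sub>R (z k j - x k))"
    using t(3) by (rule infdist_le)
  also have "\<dots> = t * norm (x k - z k j)"
    using t by (simp add: dist_norm norm_minus_commute)
  also have "\<dots> \<le> q * norm (x k - z k (jk k))"
    using t norm_z_le_norm_z_jk[OF j] by (intro mult_mono) auto
  finally show ?thesis .
qed

lemma limit_in_Dj:
  assumes "convex_on UNIV (fs j)" and "j \<in> {1..m}"
    and "bounded (range x)" and "strict_mono r" and "(\<lambda>i. x (r i)) \<longlonglongrightarrow> p"
  shows "p \<in> Dj fs j"
proof -
  have "(\<lambda>i. infdist (x (r i)) (Dj fs j)) \<longlonglongrightarrow> 0"
  proof (rule Lim_null_comparison)
    show "\<forall>\<^sub>F i in sequentially. norm (infdist (x (r i)) (Dj fs j))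
        \<le> q * norm (x (r i) - z (r i) (jk (r i)))"
      using infdist_x_Dj_le[OF assms(2)] by (simp add: infdist_nonneg)
    show "(\<lambda>i. q * norm (x (r i) - z (r i) (jk (r i)))) \<longlonglongrightarrow> 0"
      using norm_x_z_jk_subseq_tendsto_zero[OF assms(3-5)] by (rule tendsto_mult_right_zero)
  qed
  moreover have "(\<lambda>i. infdist (x (r i)) (Dj fs j)) \<longlonglongrightarrow> infdist p (Dj fs j)"
    using assms(5) by (rule tendsto_infdist)
  ultimately have "infdist p (Dj fs j) = 0" using LIMSEQ_unique by blast
  moreover have "closed (Dj fs j)"
    using closed_sublevel_convex_on[OF assms(1)] by (simp add: Dj_def)
  moreover have "Dj fs j \<noteq> {}" using y_interior[OF assms(2)] interior_subset by blast
  ultimately show ?thesis using in_closed_iff_infdist_zero by blast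
qed

lemma f_limit_le_fstar:
  assumes "continuous_on UNIV f" and "(\<lambda>i. x (r i)) \<longlonglongrightarrow> p"
  shows "f p \<le> fstar m fs f"
proof -
  have "isCont f p" using assms(1) by (simp add: continuous_on_eq_continuous_at)
  then have "(\<lambda>i. f (x (r i))) \<longlonglongrightarrow> f p" using assms(2) by (rule isCont_tendsto_compose)
  then show ?thesis using f_x_le_fstar by (intro LIMSEQ_le_const2) auto
qed

end

theorem theorem1p4p1:
  fixes m :: nat and fs :: "nat \<Rightarrow> 'a::euclidean_space \<Rightarrow> real" and f :: "'a \<Rightarrow> real"
    and y :: "nat \<Rightarrow> 'a" and q :: real and M :: "nat \<Rightarrow> 'a set" and x :: "nat \<Rightarrow> 'a"
    and z :: "nat \<Rightarrow> nat \<Rightarrow> 'a" and A :: "nat \<Rightarrow> nat \<Rightarrow> 'a set" and u :: "nat \<Rightarrow> nat \<Rightarrow> 'a"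
    and jk lk :: "nat \<Rightarrow> nat"
  assumes convex_fs: "\<And>j. j \<in> {1..m} \<Longrightarrow> convex_on UNIV (fs j)"
    and int_Dj: "\<And>j. j \<in> {1..m} \<Longrightarrow> interior (Dj fs j) \<noteq> {}"
    and cont_f: "continuous_on UNIV f"
    and attains: "\<exists>x0\<in>Dset m fs. \<forall>x\<in>Dset m fs. f x0 \<le> f x"
    and run: "method14_run m fs f y q M x z A u jk lk"
    and bdd: "bounded (range x)"
  shows "\<forall>p. (\<exists>r. strict_mono r \<and> (x \<circ> r) \<longlonglongrightarrow> p) \<longrightarrow> p \<in> Xstar m fs f"
proof (intro allI impI)
  interpret method14 m fs f y q M x z A u jk lk by (rule method14.intro[OF run])
  fix p assume "\<exists>r. strict_mono r \<and> (x \<circ> r) \<longlonglongrightarrow> p"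
  then obtain r where r: "strict_mono r" and lim: "(\<lambda>i. x (r i)) \<longlonglongrightarrow> p"
    by (auto simp: o_def)
  have "p \<in> Dset m fs"
    using limit_in_Dj[OF convex_fs _ bdd r lim] by (auto simp: Dset_def Dj_def)
  with f_limit_le_fstar[OF cont_f lim] fstar_le[OF attains] show "p \<in> Xstar m fs f"
    by (auto simp: Xstar_def intro: antisym)
qed

end
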